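(* Let $n\geq 2$ be an integer and let $\varphi:H_n^+(\mathbb{R})\to H_n^+(\mathbb{R})$ be a map. Then $\varphi$ is surjective and preserves the Löwner order $\leq^L$ in both directions if and only if there exists an invertible matrix $S\in M_n(\mathbb{R})$ such that $\varphi(A)=SAS^t$ for every $A\in H_n^+(\mathbb{R})$.
   Context: $M_n(\mathbb{R})$ is the set of real $n\times n$ matrices and $A^t$ denotes the transpose of $A$. $H_n^+(\mathbb{R})$ is the set of all positive semidefinite real $n\times n$ matrices, i.e. symmetric $A\in M_n(\mathbb{R})$ with $x^tAx\geq 0$ for every $x\in\mathbb{R}^n$. For symmetric $A,B\in M_n(\mathbb{R})$, the Löwner partial order is defined by: $A\leq^L B$ if $B-A$ is positive semidefinite. The map $\varphi$ preserves $\leq^L$ in both directions if, for all $A,B\in H_n^+(\mathbb{R})$, $A\leq^L B$ if and only if $\varphi(A)\leq^L\varphi(B)$. No linearity, continuity or injectivity of $\varphi$ is assumed. *)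

theory Defs
  imports "HOL-Analysis.Analysis"
begin

definition psd_matrices :: "(real ^ 'n ^ 'n) set" where
  "psd_matrices = {A. transpose A = A \<and> (\<forall>x. 0 \<le> x \<bullet> (A *v x))}"

text \<open>The order below is meaningful for symmetric matrices only.\<close>

definition loewner_le :: "real ^ 'n ^ 'n \<Rightarrow> real ^ 'n ^ 'n \<Rightarrow> bool"  (infix "\<le>\<^sup>L" 50) where
  "A \<le>\<^sup>L B \<longleftrightarrow> B - A \<in> psd_matrices"

definition preserves_loewner_both :: "(real ^ 'n ^ 'n \<Rightarrow> real ^ 'n ^ 'n) \<Rightarrow> bool" where
  "preserves_loewner_both \<phi> \<longleftrightarrow>
     (\<forall>A \<in> psd_matrices. \<forall>B \<in> psd_matrices. A \<le>\<^sup>L B \<longleftrightarrow> \<phi> A \<le>\<^sup>L \<phi> B)"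

end

theory Submission
  imports Defs
begin

text \<open>
  A congruence \<open>A \<mapsto> S A S\<^sup>t\<close> with invertible \<open>S\<close> is clearly an order automorphism of the cone of
  positive semidefinite matrices; the substance is the converse, where neither additivity nor
  homogeneity of \<open>\<phi>\<close> is given.  Both are forced by the extreme rays of the cone, the dyads
  \<open>y y\<^sup>t\<close>.

  The matrices between 0 and \<open>C\<close> form a chain exactly when \<open>C\<close> is a dyad, and by translation invariance
  those between \<open>A\<close> and \<open>B\<close> do exactly when \<open>B - A\<close> is one (\<open>loewner_chain_iff\<close>).  Hence \<open>\<phi> (A + y y\<^sup>t) = \<phi> A + z z\<^sup>t\<close> for some \<open>z\<close>.
  The direction of \<open>z\<close> does not depend on \<open>A\<close>: as \<open>t\<close> grows, \<open>A + t y y\<^sup>t\<close> dominates arbitrarily long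
  dyads in the direction of \<open>y\<close> and in no other direction, so \<open>z z\<^sup>t\<close> is a multiple of
  \<open>\<phi> (y y\<^sup>t)\<close> (\<open>add_dyad_direction\<close>).

  The length of \<open>z\<close> does not depend on \<open>A\<close> either.  For independent \<open>y\<close> and \<open>z\<close>, adding the two dyads
  to \<open>A\<close> in either order gives the same value, and the images of the dyads are linearly independent;
  comparing coefficients, the increment along \<open>y\<close> is unchanged when \<open>A\<close> is replaced by \<open>A + z z\<^sup>t\<close>.
  For parallel \<open>y\<close> and \<open>z\<close> one adds a dyad \<open>x x\<^sup>t\<close> in a second direction (here the dimension must be at
  least 2) and rewrites \<open>z z\<^sup>t + x x\<^sup>t\<close> as a sum of two dyads in directions other than that of \<open>y\<close>.
  So \<open>\<phi>\<close> is additive on sums of dyads (\<open>additive\<close>), and monotonicity makes it homogeneous on each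
  ray (\<open>homogeneous_dyad\<close>).

  Write \<open>\<phi> (y y\<^sup>t) = r r\<^sup>t\<close> with \<open>r = root y\<close>, which is determined up to sign.  Additivity and positivity
  force \<open>root (x + y) = \<plusminus> root x \<plusminus> root y\<close> (\<open>root_add_up_to_sign\<close>).  Consistent signs come from
  polarization: for a fixed \<open>x \<noteq> 0\<close> with \<open>u = root x\<close>, the matrix
  \<open>\<phi> ((x + y)(x + y)\<^sup>t) - \<phi> (x x\<^sup>t) - \<phi> (y y\<^sup>t)\<close> is linear in \<open>y\<close> and equals
  \<open>u v\<^sup>t + v u\<^sup>t\<close> with \<open>v = \<plusminus> root y\<close>, and \<open>v\<close> can be read off from it linearly.  This linear map is the
  matrix \<open>S\<close> (\<open>linear_on_dyads\<close>).  Finally, a positive semidefinite matrix is determined by the dyads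
  below it (\<open>loewner_le_if_dyads_below\<close>), so \<open>\<phi> A = S A S\<^sup>t\<close> holds everywhere.
\<close>

section \<open>Positive semidefinite matrices and dyads\<close>

definition dyad :: "real ^ 'n \<Rightarrow> real ^ 'n ^ 'n" where
  "dyad y = (\<chi> i j. y $ i * y $ j)"

lemma dyad_mult_vec: "dyad y *v x = (y \<bullet> x) *\<^sub>R y"
  by (simp add: dyad_def matrix_vector_mult_def vec_eq_iff inner_vec_def sum_distrib_left
      mult.assoc mult.left_commute mult.commute)

lemma inner_dyad: "x \<bullet> (dyad y *v x) = (y \<bullet> x)\<^sup>2"
  by (simp add: dyad_mult_vec power2_eq_square inner_commute)

lemma dyad_zero [simp]: "dyad 0 = 0"
  by (simp add: dyad_def vec_eq_iff)

lemma dyad_scaleR: "dyad (c *\<^sub>R y) = c\<^sup>2 *\<^sub>R dyad y"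
  by (simp add: dyad_def vec_eq_iff power2_eq_square)

lemma transpose_dyad [simp]: "transpose (dyad y) = dyad y"
  by (simp add: dyad_def transpose_def vec_eq_iff mult.commute)

lemma dyad_eq_zero [simp]: "dyad y = 0 \<longleftrightarrow> y = 0"
proof
  assume "dyad y = 0"
  then have "(y \<bullet> y)\<^sup>2 = 0" using inner_dyad[of y y] by simp
  then show "y = 0" by simp
qed simp

lemma dyad_sqrt: "0 \<le> t \<Longrightarrow> t *\<^sub>R dyad y = dyad (sqrt t *\<^sub>R y)"
  by (simp add: dyad_scaleR)

lemma congruence_dyad: "S ** dyad y ** transpose S = dyad (S *v y)"
  by (simp add: dyad_def vec_eq_iff matrix_matrix_mult_def matrix_vector_mult_def transpose_def
      sum_distrib_left sum_distrib_right mult.assoc mult.left_commute mult.commute)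

lemma mat_vec_scaleR: "(c *\<^sub>R A) *v x = c *\<^sub>R (A *v x)" for A :: "real ^ 'n ^ 'm"
  by (simp add: scaleR_matrix_vector_assoc)

lemma psd_zero [simp]: "0 \<in> psd_matrices"
  by (simp add: psd_matrices_def transpose_def vec_eq_iff)

lemma psd_dyad [simp]: "dyad y \<in> psd_matrices"
  by (simp add: psd_matrices_def inner_dyad)

lemma psd_add: "A \<in> psd_matrices \<Longrightarrow> B \<in> psd_matrices \<Longrightarrow> A + B \<in> psd_matrices"
  by (auto simp: psd_matrices_def transpose_def vec_eq_iff matrix_vector_mult_add_rdistrib
      inner_add_right)

lemma psd_scaleR: "A \<in> psd_matrices \<Longrightarrow> 0 \<le> c \<Longrightarrow> c *\<^sub>R A \<in> psd_matrices"
  by (auto simp: psd_matrices_def transpose_def vec_eq_iff mat_vec_scaleR)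

lemma psd_inner_swap: "A \<in> psd_matrices \<Longrightarrow> x \<bullet> (A *v y) = (A *v x) \<bullet> y"
  by (metis (mono_tags, lifting) dot_lmul_matrix mem_Collect_eq psd_matrices_def
      transpose_matrix_vector)

lemma psd_nonneg: "A \<in> psd_matrices \<Longrightarrow> 0 \<le> x \<bullet> (A *v x)"
  by (simp add: psd_matrices_def)

lemma loewner_le_quadratic: "A \<le>\<^sup>L B \<Longrightarrow> x \<bullet> (A *v x) \<le> x \<bullet> (B *v x)"
  by (auto simp: loewner_le_def psd_matrices_def matrix_vector_mult_diff_rdistrib inner_diff_right)

lemma loewner_le_iff_quadratic:
  assumes "A \<in> psd_matrices" "B \<in> psd_matrices"
  shows "A \<le>\<^sup>L B \<longleftrightarrow> (\<forall>x. x \<bullet> (A *v x) \<le> x \<bullet> (B *v x))"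
  using assms
  by (auto simp: loewner_le_def psd_matrices_def matrix_vector_mult_diff_rdistrib inner_diff_right
      transpose_def vec_eq_iff)

lemma loewner_refl [simp]: "A \<le>\<^sup>L A"
  by (simp add: loewner_le_def)

lemma loewner_trans: "A \<le>\<^sup>L B \<Longrightarrow> B \<le>\<^sup>L C \<Longrightarrow> A \<le>\<^sup>L C"
  unfolding loewner_le_def using psd_add by fastforce

lemma zero_loewner_le [simp]: "0 \<le>\<^sup>L A \<longleftrightarrow> A \<in> psd_matrices"
  by (simp add: loewner_le_def)

lemma loewner_add_left [simp]: "C + A \<le>\<^sup>L C + B \<longleftrightarrow> A \<le>\<^sup>L B"
  by (simp add: loewner_le_def)

lemma loewner_le_add: "B \<in> psd_matrices \<Longrightarrow> A \<le>\<^sup>L A + B"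
  by (simp add: loewner_le_def)

lemma loewner_scaleR_mono:
  assumes "A \<in> psd_matrices" "s \<le> t"
  shows "s *\<^sub>R A \<le>\<^sup>L t *\<^sub>R A"
  using psd_scaleR[OF assms(1), of "t - s"] assms(2) by (simp add: loewner_le_def scaleR_diff_left)

text \<open>
  The quadratic form of \<open>A\<close> is nonnegative on the line \<open>x + t y\<close>, so the discriminant of the
  resulting quadratic in \<open>t\<close> is at most 0.
\<close>

lemma psd_Cauchy_Schwarz:
  assumes A: "A \<in> psd_matrices"
  shows "(x \<bullet> (A *v y))\<^sup>2 \<le> (x \<bullet> (A *v x)) * (y \<bullet> (A *v y))"
proof -
  define a where "a = x \<bullet> (A *v x)"
  define b where "b = x \<bullet> (A *v y)"
  define c where "c = y \<bullet> (A *v y)"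
  have q: "0 \<le> a + 2 * t * b + t\<^sup>2 * c" for t
  proof -
    have "y \<bullet> (A *v x) = b"
      unfolding b_def by (metis A inner_commute psd_inner_swap)
    then have "(x + t *\<^sub>R y) \<bullet> (A *v (x + t *\<^sub>R y)) = a + 2 * t * b + t\<^sup>2 * c"
      by (simp add: a_def b_def c_def matrix_vector_right_distrib
          matrix_vector_mult_scaleR inner_add_left inner_add_right power2_eq_square algebra_simps)
    then show ?thesis using psd_nonneg[OF A, of "x + t *\<^sub>R y"] by simp
  qed
  have c0: "0 \<le> c" unfolding c_def by (rule psd_nonneg[OF A])
  have "b\<^sup>2 \<le> a * c"
  proof (cases "c = 0")
    case True
    \<comment> \<open>The quadratic degenerates to an affine function of \<open>t\<close>, which is bounded below only if constant.\<close>
    have "b = 0"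
    proof (rule ccontr)
      assume "b \<noteq> 0"
      then show False using q[of "- (a + 1) / (2 * b)"] True by (simp add: field_simps)
    qed
    then show ?thesis using True by simp
  next
    case False
    then have "0 \<le> (a + 2 * (- b / c) * b + (- b / c)\<^sup>2 * c) * c"
      using q[of "- b / c"] c0 by (intro mult_nonneg_nonneg)
    also have "\<dots> = a * c - b\<^sup>2"
      using False by (simp add: field_simps power2_eq_square)
    finally show ?thesis by simp
  qed
  then show ?thesis by (simp add: a_def b_def c_def)
qed

lemma psd_kernel:
  assumes "A \<in> psd_matrices" "x \<bullet> (A *v x) = 0"
  shows "A *v x = 0"
  using psd_Cauchy_Schwarz[OF assms(1), of "A *v x" x] assms(2) by simp

lemma psd_pos:
  assumes "A \<in> psd_matrices" "A *v x \<noteq> 0"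
  shows "0 < x \<bullet> (A *v x)"
  using psd_kernel[OF assms(1)] psd_nonneg[OF assms(1)] assms(2) by (metis order_le_less)

text \<open>
  This is Cauchy--Schwarz read as an operator inequality; it is the source of all dyads below
  \<open>A\<close> that are used later.  For \<open>y\<close> in the kernel of \<open>A\<close> the left-hand side is 0.
\<close>

lemma dyad_below:
  assumes A: "A \<in> psd_matrices"
  shows "(1 / (y \<bullet> (A *v y))) *\<^sub>R dyad (A *v y) \<le>\<^sup>L A"
proof -
  have c0: "0 \<le> y \<bullet> (A *v y)" by (rule psd_nonneg[OF A])
  show ?thesis
  proof (subst loewner_le_iff_quadratic, goal_cases)
    case 1 then show ?case using c0 by (intro psd_scaleR) auto
  next
    case 2 then show ?case by (rule A)
  next
    case 3
    show ?case
    proof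
      fix x
      have "(x \<bullet> (A *v y))\<^sup>2 \<le> (x \<bullet> (A *v x)) * (y \<bullet> (A *v y))"
        by (rule psd_Cauchy_Schwarz[OF A])
      then show "x \<bullet> ((1 / (y \<bullet> (A *v y))) *\<^sub>R dyad (A *v y) *v x) \<le> x \<bullet> (A *v x)"
        using c0 psd_nonneg[OF A, of x]
        by (cases "y \<bullet> (A *v y) = 0")
          (auto simp: mat_vec_scaleR inner_dyad inner_commute field_simps)
    qed
  qed
qed

text \<open>
  The dyad from \<open>dyad_below\<close> at \<open>y\<close> touches \<open>A\<close>: its quadratic form agrees with that of \<open>A\<close> at
  \<open>y\<close>.  So comparing that one dyad with \<open>B\<close> already yields the inequality of the forms at \<open>y\<close>.
\<close>

lemma loewner_le_if_dyads_below:
  assumes A: "A \<in> psd_matrices" and B: "B \<in> psd_matrices"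
    and le: "\<And>y. dyad y \<le>\<^sup>L A \<Longrightarrow> dyad y \<le>\<^sup>L B"
  shows "A \<le>\<^sup>L B"
  unfolding loewner_le_iff_quadratic[OF A B]
proof
  fix y
  define c where "c = y \<bullet> (A *v y)"
  have c0: "0 \<le> c" unfolding c_def by (rule psd_nonneg[OF A])
  show "y \<bullet> (A *v y) \<le> y \<bullet> (B *v y)"
  proof (cases "c = 0")
    case True then show ?thesis using psd_nonneg[OF B, of y] by (simp add: c_def)
  next
    case False
    have "(1 / c) *\<^sub>R dyad (A *v y) \<le>\<^sup>L A" unfolding c_def by (rule dyad_below[OF A])
    then have "(1 / c) *\<^sub>R dyad (A *v y) \<le>\<^sup>L B"
      using le c0 by (simp add: dyad_sqrt del: real_sqrt_divide)
    from loewner_le_quadratic[OF this, of y] have "(1 / c) * c\<^sup>2 \<le> y \<bullet> (B *v y)"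
      by (simp add: mat_vec_scaleR inner_dyad c_def inner_commute)
    then show ?thesis using False by (simp add: power2_eq_square c_def)
  qed
qed

lemma loewner_antisym:
  assumes "A \<le>\<^sup>L B" "B \<le>\<^sup>L A"
  shows "A = B"
proof -
  have D: "B - A \<in> psd_matrices" using assms(1) by (simp add: loewner_le_def)
  have "(B - A) *v x = 0" for x
  proof (rule psd_kernel[OF D])
    show "x \<bullet> ((B - A) *v x) = 0"
      using loewner_le_quadratic[OF assms(1), of x] loewner_le_quadratic[OF assms(2), of x]
      by (simp add: matrix_vector_mult_diff_rdistrib inner_diff_right)
  qed
  then have "B - A = 0" by (simp add: matrix_eq)
  then show ?thesis by simp
qed

section \<open>Rank one and chains\<close>

text \<open>
  Test vectors for quadratic forms: evaluated at \<open>w\<close>, multiples of \<open>dyad y\<close> vanish while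
  \<open>dyad z\<close> does not.
\<close>

lemma separating_vector:
  fixes y z :: "'a :: real_inner"
  assumes "z \<notin> span {y}"
  obtains w where "w \<bullet> y = 0" "w \<bullet> z \<noteq> 0"
proof
  define w where "w = z - ((z \<bullet> y) / (y \<bullet> y)) *\<^sub>R y"
  show wy: "w \<bullet> y = 0" by (simp add: w_def inner_diff_left)
  have "w \<noteq> 0"
    using assms by (auto simp: w_def span_singleton)
  moreover have "w \<bullet> z = w \<bullet> w"
    using wy by (simp add: w_def inner_diff_right)
  ultimately show "w \<bullet> z \<noteq> 0" by simp
qed

lemma span_singleton_swap:
  fixes y z :: "'a :: real_vector"
  assumes "z \<in> span {y}" "z \<noteq> 0"
  shows "y \<in> span {z}"
proof -
  obtain c where c: "z = c *\<^sub>R y" using assms(1) by (auto simp: span_singleton)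
  then have "y = (1 / c) *\<^sub>R z" using assms(2) by auto
  then show ?thesis by (metis rangeI span_singleton)
qed

lemma dyad_le_dyad_imp_parallel:
  assumes "dyad z \<le>\<^sup>L s *\<^sub>R dyad y"
  shows "z \<in> span {y}"
proof (rule ccontr)
  assume "z \<notin> span {y}"
  then obtain w where "w \<bullet> y = 0" "w \<bullet> z \<noteq> 0" by (rule separating_vector)
  then show False
    using loewner_le_quadratic[OF assms, of w]
    by (simp add: mat_vec_scaleR inner_dyad inner_commute)
qed

text \<open>
  Parallelism of vectors expressed by the order alone, hence visible to an order automorphism.
\<close>

lemma dyads_comparable_iff:
  assumes "y \<noteq> 0"
  shows "dyad z \<le>\<^sup>L dyad y \<or> dyad y \<le>\<^sup>L dyad z \<longleftrightarrow> z \<in> span {y}"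
proof
  assume "dyad z \<le>\<^sup>L dyad y \<or> dyad y \<le>\<^sup>L dyad z"
  then have "z \<in> span {y} \<or> y \<in> span {z}"
    using dyad_le_dyad_imp_parallel[of _ 1] by simp blast
  then show "z \<in> span {y}" using assms span_singleton_swap by blast
next
  assume "z \<in> span {y}"
  then obtain c where c: "z = c *\<^sub>R y" by (auto simp: span_singleton)
  have "c\<^sup>2 \<le> 1 \<or> 1 \<le> c\<^sup>2" by linarith
  then show "dyad z \<le>\<^sup>L dyad y \<or> dyad y \<le>\<^sup>L dyad z"
    using loewner_scaleR_mono[OF psd_dyad, of "c\<^sup>2" 1 y]
      loewner_scaleR_mono[OF psd_dyad, of 1 "c\<^sup>2" y]
    by (auto simp: c dyad_scaleR)
qed

text \<open>
  Dyads generate extreme rays of the cone.  By \<open>dyad_below\<close> every vector in the range of \<open>X\<close> gives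
  a dyad below \<open>dyad y\<close>, so the range lies in the line of \<open>y\<close>, and symmetry of \<open>X\<close> does the rest.
\<close>

lemma below_dyad:
  assumes X: "X \<in> psd_matrices" and le: "X \<le>\<^sup>L dyad y"
  obtains t where "0 \<le> t" "X = t *\<^sub>R dyad y"
proof (cases "y = 0")
  case True
  then have "X = 0" using le X by (intro loewner_antisym) auto
  then show ?thesis using that[of 0] by simp
next
  case False
  have "X *v v \<in> span {y}" for v
  proof (cases "X *v v = 0")
    case False
    define c where "c = v \<bullet> (X *v v)"
    have "0 < c" unfolding c_def using psd_pos[OF X False] .
    have "(1 / c) *\<^sub>R dyad (X *v v) \<le>\<^sup>L dyad y"
      unfolding c_def using dyad_below[OF X] le by (rule loewner_trans)
    then have "dyad (sqrt (1 / c) *\<^sub>R (X *v v)) \<le>\<^sup>L 1 *\<^sub>R dyad y"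
      using \<open>0 < c\<close> by (simp add: dyad_sqrt del: real_sqrt_divide)
    then have "sqrt (1 / c) *\<^sub>R (X *v v) \<in> span {y}" by (rule dyad_le_dyad_imp_parallel)
    then have "(1 / sqrt (1 / c)) *\<^sub>R (sqrt (1 / c) *\<^sub>R (X *v v)) \<in> span {y}" by (rule span_scale)
    then show ?thesis using \<open>0 < c\<close> by (simp del: real_sqrt_divide)
  qed (simp add: span_zero)
  then have "\<exists>l. X *v v = l *\<^sub>R y" for v by (auto simp: span_singleton)
  then obtain l where l: "\<And>v. X *v v = l v *\<^sub>R y" by metis
  define t where "t = l y / (y \<bullet> y)"
  have "X *v v = (t *\<^sub>R dyad y) *v v" for v
  proof -
    have "l v * (y \<bullet> y) = l y * (y \<bullet> v)"
      using psd_inner_swap[OF X, of y v] by (simp add: l)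
    then have "l v = t * (y \<bullet> v)" using False by (simp add: t_def field_simps)
    then show ?thesis by (simp add: l mat_vec_scaleR dyad_mult_vec)
  qed
  then have eq: "X = t *\<^sub>R dyad y" by (simp add: matrix_eq)
  moreover have "0 \<le> t * (y \<bullet> y)\<^sup>2"
    using psd_nonneg[OF X, of y] by (simp add: eq mat_vec_scaleR inner_dyad)
  then have "0 \<le> t" using False by (simp add: zero_le_mult_iff)
  ultimately show ?thesis using that by blast
qed

definition loewner_chain :: "real ^ 'n ^ 'n \<Rightarrow> real ^ 'n ^ 'n \<Rightarrow> bool" where
  "loewner_chain A B \<longleftrightarrow> A \<le>\<^sup>L B \<and>
     (\<forall>X Y. A \<le>\<^sup>L X \<and> X \<le>\<^sup>L B \<and> A \<le>\<^sup>L Y \<and> Y \<le>\<^sup>L B \<longrightarrow> X \<le>\<^sup>L Y \<or> Y \<le>\<^sup>L X)"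

text \<open>
  Subtract from \<open>C\<close> the dyad \<open>dyad u\<close> that touches it at some \<open>x\<close>.  If the remainder \<open>D\<close> were
  nonzero, it would dominate a dyad \<open>dyad v\<close>; the chain condition makes \<open>v\<close> parallel to \<open>u\<close>, but
  \<open>v\<close> is orthogonal to \<open>x\<close> because \<open>D\<close> kills \<open>x\<close>, and \<open>u\<close> is not.
\<close>

lemma chain_below_imp_dyad:
  assumes C: "C \<in> psd_matrices"
    and chain: "\<And>X Y. \<lbrakk>X \<in> psd_matrices; X \<le>\<^sup>L C; Y \<in> psd_matrices; Y \<le>\<^sup>L C\<rbrakk>
      \<Longrightarrow> X \<le>\<^sup>L Y \<or> Y \<le>\<^sup>L X"
  shows "\<exists>y. C = dyad y"
proof (cases "C = 0")
  case True then show ?thesis by (intro exI[of _ 0]) simp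
next
  case False
  then obtain x where x: "C *v x \<noteq> 0" by (metis matrix_eq matrix_vector_mult_0)
  define c where "c = x \<bullet> (C *v x)"
  have c: "0 < c" unfolding c_def by (rule psd_pos[OF C x])
  define u where "u = sqrt (1 / c) *\<^sub>R (C *v x)"
  have du: "dyad u = (1 / c) *\<^sub>R dyad (C *v x)"
    unfolding u_def using c by (simp add: dyad_sqrt del: real_sqrt_divide)
  have uC: "dyad u \<le>\<^sup>L C" unfolding du c_def by (rule dyad_below[OF C])
  have xu: "u \<bullet> x \<noteq> 0"
    using c by (simp add: u_def c_def inner_commute)
  define D where "D = C - dyad u"
  have D: "D \<in> psd_matrices" using uC by (simp add: D_def loewner_le_def)
  have Dx: "D *v x = 0"
    using c by (simp add: D_def matrix_vector_mult_diff_rdistrib du mat_vec_scaleR dyad_mult_vec c_def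
      inner_commute)
  have "D *v y = 0" for y
  proof (rule ccontr)
    assume y: "D *v y \<noteq> 0"
    define d where "d = y \<bullet> (D *v y)"
    have d: "0 < d" unfolding d_def by (rule psd_pos[OF D y])
    define v where "v = sqrt (1 / d) *\<^sub>R (D *v y)"
    have dv: "dyad v = (1 / d) *\<^sub>R dyad (D *v y)"
      unfolding v_def using d by (simp add: dyad_sqrt del: real_sqrt_divide)
    have vD: "dyad v \<le>\<^sup>L D" unfolding dv d_def by (rule dyad_below[OF D])
    have "D \<le>\<^sup>L C" by (simp add: D_def loewner_le_def)
    with vD have vC: "dyad v \<le>\<^sup>L C" by (rule loewner_trans)
    have v0: "v \<noteq> 0" using y d by (simp add: v_def)
    have vx: "v \<bullet> x = 0"
      using psd_inner_swap[OF D, of y x] Dx by (simp add: v_def)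
    have "dyad u \<le>\<^sup>L 1 *\<^sub>R dyad v \<or> dyad v \<le>\<^sup>L 1 *\<^sub>R dyad u"
      using chain[OF psd_dyad uC psd_dyad vC] by simp
    then have "u \<in> span {v}"
      using dyad_le_dyad_imp_parallel span_singleton_swap v0 by blast
    then show False using vx xu by (auto simp: span_singleton)
  qed
  then have "D = 0" by (simp add: matrix_eq)
  then show ?thesis by (auto simp: D_def)
qed

text \<open>
  The left-hand side mentions nothing but the order, so order automorphisms carry dyadic
  differences to dyadic differences.
\<close>

lemma loewner_chain_iff: "loewner_chain A B \<longleftrightarrow> (\<exists>y. B = A + dyad y)"
proof
  assume ch: "loewner_chain A B"
  have "\<exists>y. B - A = dyad y"
  proof (rule chain_below_imp_dyad)
    show "B - A \<in> psd_matrices" using ch by (simp add: loewner_chain_def loewner_le_def)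
  next
    fix X Y
    assume "X \<in> psd_matrices" "X \<le>\<^sup>L B - A" "Y \<in> psd_matrices" "Y \<le>\<^sup>L B - A"
    then have "A \<le>\<^sup>L A + X" "A + X \<le>\<^sup>L B" "A \<le>\<^sup>L A + Y" "A + Y \<le>\<^sup>L B"
      by (simp_all add: loewner_le_def algebra_simps)
    then have "A + X \<le>\<^sup>L A + Y \<or> A + Y \<le>\<^sup>L A + X"
      using ch unfolding loewner_chain_def by blast
    then show "X \<le>\<^sup>L Y \<or> Y \<le>\<^sup>L X" by simp
  qed
  then show "\<exists>y. B = A + dyad y" by (metis add.commute diff_add_cancel)
next
  assume "\<exists>y. B = A + dyad y"
  then obtain y where B: "B = A + dyad y" ..
  have par: "\<exists>t. X = A + t *\<^sub>R dyad y" if "A \<le>\<^sup>L X" "X \<le>\<^sup>L B" for X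
  proof -
    have "X - A \<in> psd_matrices" "X - A \<le>\<^sup>L dyad y"
      using that by (simp_all add: loewner_le_def B algebra_simps)
    then obtain t where "X - A = t *\<^sub>R dyad y" by (rule below_dyad)
    then show ?thesis by (metis add.commute diff_add_cancel)
  qed
  show "loewner_chain A B"
    unfolding loewner_chain_def
  proof (intro conjI allI impI)
    show "A \<le>\<^sup>L B" by (simp add: B loewner_le_add)
  next
    fix X Y assume *: "A \<le>\<^sup>L X \<and> X \<le>\<^sup>L B \<and> A \<le>\<^sup>L Y \<and> Y \<le>\<^sup>L B"
    then obtain s t where st: "X = A + s *\<^sub>R dyad y" "Y = A + t *\<^sub>R dyad y" using par by meson
    have "s \<le> t \<or> t \<le> s" by linarith
    then show "X \<le>\<^sup>L Y \<or> Y \<le>\<^sup>L X"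
      unfolding st loewner_add_left using loewner_scaleR_mono[OF psd_dyad] by blast
  qed
qed

lemma scaled_dyads_eq_imp_zero:
  assumes "a *\<^sub>R dyad u = b *\<^sub>R dyad v" "u \<notin> span {v}"
  shows "a = 0"
proof -
  obtain w where w: "w \<bullet> v = 0" "w \<bullet> u \<noteq> 0" using assms(2) by (rule separating_vector)
  have "w \<bullet> ((a *\<^sub>R dyad u) *v w) = w \<bullet> ((b *\<^sub>R dyad v) *v w)" using assms(1) by simp
  then show ?thesis using w by (simp add: mat_vec_scaleR inner_dyad inner_commute)
qed

lemma dyad_eq_imp:
  assumes "dyad u = dyad v"
  shows "u = v \<or> u = - v"
proof (cases "v = 0")
  case True then show ?thesis using assms by simp
next
  case False
  have "u \<in> span {v}" by (rule dyad_le_dyad_imp_parallel[of _ 1]) (simp add: assms)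
  then obtain c where c: "u = c *\<^sub>R v" by (auto simp: span_singleton)
  then have "(c\<^sup>2 - 1) *\<^sub>R dyad v = 0" using assms by (simp add: dyad_scaleR scaleR_diff_left)
  then have "c\<^sup>2 = 1" using False by simp
  then show ?thesis using c by (auto simp: power2_eq_1_iff)
qed

section \<open>Sums of dyads and additive functions\<close>

text \<open>
  By the spectral theorem these are all positive semidefinite matrices, but the inductive
  description gives the induction on the number of summands that additivity rests on.
\<close>

inductive_set dyad_sums :: "(real ^ 'n ^ 'n) set" where
  zero: "0 \<in> dyad_sums"
| add: "A \<in> dyad_sums \<Longrightarrow> A + dyad y \<in> dyad_sums"

lemma dyad_sums_psd: "A \<in> dyad_sums \<Longrightarrow> A \<in> psd_matrices"
  by (induction rule: dyad_sums.induct) (auto intro: psd_add)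

lemma dyad_in_dyad_sums: "dyad y \<in> dyad_sums"
  using dyad_sums.add[OF dyad_sums.zero, of y] by simp

text \<open>
  Cauchy's functional equation on the half-line.  Nonnegativity makes \<open>f\<close> monotone, and squeezing
  \<open>n t\<close> between consecutive integers bounds \<open>n\<close> times the deviation from linearity by \<open>f 1\<close> for
  every \<open>n\<close>.
\<close>

lemma additive_nonneg_imp_linear:
  fixes f :: "real \<Rightarrow> real"
  assumes add: "\<And>s t. 0 \<le> s \<Longrightarrow> 0 \<le> t \<Longrightarrow> f (s + t) = f s + f t"
    and nonneg: "\<And>t. 0 \<le> t \<Longrightarrow> 0 \<le> f t"
    and t: "0 \<le> t"
  shows "f t = t * f 1"
proof -
  have f0: "f 0 = 0" using add[of 0 0] by simp
  have mult: "f (real m * r) = real m * f r" if "0 \<le> r" for m r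
    using that by (induction m) (simp_all add: f0 add distrib_right)
  have mono: "f r \<le> f s" if "0 \<le> r" "r \<le> s" for r s
    using add[of r "s - r"] nonneg[of "s - r"] that by simp
  have "real n * \<bar>f t - t * f 1\<bar> \<le> f 1" for n
  proof -
    define m where "m = nat \<lfloor>real n * t\<rfloor>"
    have m: "real m \<le> real n * t" "real n * t \<le> real (Suc m)"
      using t by (simp_all add: m_def) linarith
    have "real m * f 1 \<le> real n * f t" "real n * f t \<le> real (Suc m) * f 1"
      using mono[of "real m" "real n * t"] mono[of "real n * t" "real (Suc m)"] m t
        mult[of 1 m] mult[of 1 "Suc m"] mult[of t n] by simp_all
    moreover have "real m * f 1 \<le> real n * t * f 1" "real n * t * f 1 \<le> real (Suc m) * f 1"
      using m nonneg[of 1] by (intro mult_right_mono; simp)+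
    ultimately have "\<bar>real n * f t - real n * t * f 1\<bar> \<le> f 1"
      by (simp add: abs_le_iff algebra_simps)
    moreover have "real n * \<bar>f t - t * f 1\<bar> = \<bar>real n * f t - real n * t * f 1\<bar>"
      using abs_mult[of "real n" "f t - t * f 1"] by (simp add: algebra_simps)
    ultimately show ?thesis by simp
  qed
  then have "\<bar>f t - t * f 1\<bar> = 0"
    using nonneg[of 1] by (intro real_archimedian_rdiv_eq_0[of _ "f 1"]) auto
  then show ?thesis by simp
qed

section \<open>Order automorphisms\<close>

locale loewner_automorphism =
  fixes \<phi> :: "real ^ 'n ^ 'n \<Rightarrow> real ^ 'n ^ 'n"
  assumes surj: "\<phi> ` psd_matrices = psd_matrices"
    and preserves: "preserves_loewner_both \<phi>"
    and dim2: "CARD('n) \<ge> 2"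
begin

lemma psd [simp]: "A \<in> psd_matrices \<Longrightarrow> \<phi> A \<in> psd_matrices"
  using surj by blast

lemma le_iff: "A \<in> psd_matrices \<Longrightarrow> B \<in> psd_matrices \<Longrightarrow> \<phi> A \<le>\<^sup>L \<phi> B \<longleftrightarrow> A \<le>\<^sup>L B"
  using preserves by (simp add: preserves_loewner_both_def)

lemma eq_iff: "A \<in> psd_matrices \<Longrightarrow> B \<in> psd_matrices \<Longrightarrow> \<phi> A = \<phi> B \<longleftrightarrow> A = B"
  by (metis le_iff loewner_antisym loewner_refl)

lemma preimage:
  assumes "B \<in> psd_matrices"
  obtains A where "A \<in> psd_matrices" "\<phi> A = B"
  using assms surj by (metis imageE)

lemma zero [simp]: "\<phi> 0 = 0"
proof -
  obtain A where A: "A \<in> psd_matrices" "\<phi> A = 0" using psd_zero by (rule preimage)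
  have "\<phi> 0 \<le>\<^sup>L \<phi> A" using A(1) by (simp add: le_iff)
  then show ?thesis unfolding A(2) by (rule loewner_antisym) simp
qed

lemma chain_iff:
  assumes A: "A \<in> psd_matrices" and B: "B \<in> psd_matrices"
  shows "loewner_chain (\<phi> A) (\<phi> B) \<longleftrightarrow> loewner_chain A B"
proof -
  have up: "X \<in> psd_matrices" if "A \<le>\<^sup>L X" "A \<in> psd_matrices" for A X :: "real ^ 'n ^ 'n"
    using loewner_trans[of 0 A X] that by simp
  show ?thesis
  proof
    assume L: "loewner_chain (\<phi> A) (\<phi> B)"
    show "loewner_chain A B"
      unfolding loewner_chain_def
    proof (intro conjI allI impI)
      show "A \<le>\<^sup>L B" using L A B by (simp add: loewner_chain_def le_iff)
    next
      fix X Y assume *: "A \<le>\<^sup>L X \<and> X \<le>\<^sup>L B \<and> A \<le>\<^sup>L Y \<and> Y \<le>\<^sup>L B"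
      then have XY: "X \<in> psd_matrices" "Y \<in> psd_matrices" using up A by blast+
      then have "\<phi> A \<le>\<^sup>L \<phi> X \<and> \<phi> X \<le>\<^sup>L \<phi> B \<and> \<phi> A \<le>\<^sup>L \<phi> Y \<and> \<phi> Y \<le>\<^sup>L \<phi> B"
        using * A B by (simp add: le_iff)
      then have "\<phi> X \<le>\<^sup>L \<phi> Y \<or> \<phi> Y \<le>\<^sup>L \<phi> X"
        using L unfolding loewner_chain_def by blast
      then show "X \<le>\<^sup>L Y \<or> Y \<le>\<^sup>L X" using XY by (simp add: le_iff)
    qed
  next
    assume R: "loewner_chain A B"
    show "loewner_chain (\<phi> A) (\<phi> B)"
      unfolding loewner_chain_def
    proof (intro conjI allI impI)
      show "\<phi> A \<le>\<^sup>L \<phi> B" using R A B by (simp add: loewner_chain_def le_iff)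
    next
      fix X Y assume *: "\<phi> A \<le>\<^sup>L X \<and> X \<le>\<^sup>L \<phi> B \<and> \<phi> A \<le>\<^sup>L Y \<and> Y \<le>\<^sup>L \<phi> B"
      then have "X \<in> psd_matrices" "Y \<in> psd_matrices" using up psd[OF A] by blast+
      then obtain X' Y' where XY: "X' \<in> psd_matrices" "\<phi> X' = X" "Y' \<in> psd_matrices" "\<phi> Y' = Y"
        by (metis preimage)
      have "X' \<le>\<^sup>L Y' \<or> Y' \<le>\<^sup>L X'"
        using R * A B XY unfolding loewner_chain_def by (metis le_iff)
      then show "X \<le>\<^sup>L Y \<or> Y \<le>\<^sup>L X" using XY by (metis le_iff)
    qed
  qed
qed

lemma add_dyad:
  assumes "A \<in> psd_matrices"
  obtains z where "\<phi> (A + dyad y) = \<phi> A + dyad z"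
  using chain_iff[OF assms psd_add[OF assms psd_dyad]] loewner_chain_iff by meson

text \<open>
  Such a vector is determined up to sign only.  The sign picked here is arbitrary for each \<open>y\<close>;
  \<open>linear_on_dyads\<close> supplies a consistent choice.
\<close>

definition root :: "real ^ 'n \<Rightarrow> real ^ 'n" where
  "root y = (SOME z. \<phi> (dyad y) = dyad z)"

lemma dyad_root: "\<phi> (dyad y) = dyad (root y)"
proof -
  obtain z where "\<phi> (0 + dyad y) = \<phi> 0 + dyad z" using psd_zero by (rule add_dyad)
  then show ?thesis unfolding root_def by (metis (mono_tags) add_0 zero someI_ex)
qed

lemma root_eq_zero [simp]: "root y = 0 \<longleftrightarrow> y = 0"
  using eq_iff[OF psd_dyad psd_zero, of y] by (simp add: dyad_root)

lemma root_zero [simp]: "root 0 = 0"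
  by simp

lemma preimage_dyad:
  obtains y where "\<phi> (dyad y) = dyad z"
proof -
  obtain A where A: "A \<in> psd_matrices" "\<phi> A = dyad z" using psd_dyad by (rule preimage)
  have "loewner_chain (\<phi> 0) (\<phi> A)" using loewner_chain_iff[of 0] A by auto
  then have "loewner_chain 0 A" using A chain_iff[OF psd_zero] by blast
  then obtain y where "A = dyad y" by (auto simp: loewner_chain_iff)
  then show ?thesis using that A by simp
qed

text \<open>
  Independent vectors stay independent, since parallelism is a property of the order.
\<close>

lemma root_parallel_iff: "root z \<in> span {root y} \<longleftrightarrow> z \<in> span {y}"
proof (cases "y = 0")
  case False
  have "root z \<in> span {root y} \<longleftrightarrow> \<phi> (dyad z) \<le>\<^sup>L \<phi> (dyad y) \<or> \<phi> (dyad y) \<le>\<^sup>L \<phi> (dyad z)"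
    using False by (simp add: dyad_root dyads_comparable_iff)
  also have "\<dots> \<longleftrightarrow> z \<in> span {y}"
    using False by (simp add: le_iff dyads_comparable_iff)
  finally show ?thesis .
qed simp

text \<open>
  The surjectivity of \<open>\<phi>\<close> restricts to each ray of dyads; in particular the images of
  \<open>t *\<^sub>R dyad y\<close> are unbounded as \<open>t\<close> grows.
\<close>

lemma ray_onto:
  assumes "0 < k" "y \<noteq> 0"
  obtains t where "0 \<le> t" "\<phi> (t *\<^sub>R dyad y) = k *\<^sub>R dyad (root y)"
proof -
  obtain b where b: "\<phi> (dyad b) = dyad (sqrt k *\<^sub>R root y)" by (rule preimage_dyad)
  then have e: "dyad (root b) = k *\<^sub>R dyad (root y)"
    using assms by (simp add: dyad_root dyad_scaleR)
  then have "root b \<in> span {root y}"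
    using dyad_le_dyad_imp_parallel[of "root b" k] by simp
  then have "b \<in> span {y}" by (simp add: root_parallel_iff)
  then obtain c where "b = c *\<^sub>R y" by (auto simp: span_singleton)
  then have "\<phi> (c\<^sup>2 *\<^sub>R dyad y) = k *\<^sub>R dyad (root y)" using e by (simp add: dyad_root flip: dyad_scaleR)
  then show ?thesis using that[of "c\<^sup>2"] by simp
qed

text \<open>
  All matrices \<open>\<phi> (A + t *\<^sub>R dyad y)\<close> with \<open>t \<ge> 1\<close> lie on one ray \<open>\<phi> A + s *\<^sub>R dyad z\<close>, because they are
  comparable and differ from \<open>\<phi> A\<close> by dyads.  They dominate \<open>\<phi> (t *\<^sub>R dyad y)\<close>, which is an unbounded
  multiple of \<open>dyad (root y)\<close>.  At a vector \<open>w\<close> orthogonal to \<open>z\<close> the quadratic forms along the ray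
  are constant, so \<open>w\<close> must be orthogonal to \<open>root y\<close> as well.
\<close>

lemma add_dyad_direction:
  assumes A: "A \<in> psd_matrices"
  obtains c where "\<phi> (A + dyad y) = \<phi> A + c *\<^sub>R \<phi> (dyad y)"
proof (cases "y = 0")
  case True then show ?thesis using that[of 0] by simp
next
  case y: False
  obtain z where z: "\<phi> (A + dyad y) = \<phi> A + dyad z" using A by (rule add_dyad)
  have z0: "z \<noteq> 0"
    using eq_iff[OF psd_add[OF A psd_dyad] A, of y] z y by auto
  have "root y \<in> span {z}"
  proof (rule ccontr)
    assume "root y \<notin> span {z}"
    then obtain w where w: "w \<bullet> z = 0" "w \<bullet> root y \<noteq> 0" by (rule separating_vector)
    \<comment> \<open>Chosen so that \<open>k *\<^sub>R dyad (root y)\<close> exceeds \<open>\<phi> A\<close> at \<open>w\<close> by 1.\<close>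
    define k where "k = (w \<bullet> (\<phi> A *v w) + 1) / (w \<bullet> root y)\<^sup>2"
    have "0 < k"
      unfolding k_def using w psd_nonneg[OF psd[OF A], of w] by (intro divide_pos_pos) auto
    then obtain t where t: "0 \<le> t" "\<phi> (t *\<^sub>R dyad y) = k *\<^sub>R dyad (root y)"
      using y by (rule ray_onto)
    \<comment> \<open>Both \<open>t *\<^sub>R dyad y\<close> and \<open>A + dyad y\<close> must lie below \<open>A + T *\<^sub>R dyad y\<close>.\<close>
    define T where "T = max t 1"
    have T1: "1 \<le> T" by (simp add: T_def)
    have T: "dyad (sqrt T *\<^sub>R y) = T *\<^sub>R dyad y" by (simp add: dyad_scaleR T_def)
    obtain v where v: "\<phi> (A + dyad (sqrt T *\<^sub>R y)) = \<phi> A + dyad v" using A by (rule add_dyad)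
    have "dyad y \<le>\<^sup>L dyad (sqrt T *\<^sub>R y)"
      unfolding T using loewner_scaleR_mono[OF psd_dyad T1, of y] by simp
    then have "\<phi> (A + dyad y) \<le>\<^sup>L \<phi> (A + dyad (sqrt T *\<^sub>R y))"
      using A by (simp add: le_iff psd_add)
    then have "dyad z \<le>\<^sup>L 1 *\<^sub>R dyad v" by (simp add: z v)
    then have "v \<in> span {z}"
      using dyad_le_dyad_imp_parallel span_singleton_swap z0 by blast
    then have wv: "v \<bullet> w = 0" using w by (auto simp: span_singleton inner_commute)
    have "t *\<^sub>R dyad y \<le>\<^sup>L dyad (sqrt T *\<^sub>R y)"
      unfolding T by (rule loewner_scaleR_mono) (simp_all add: T_def)
    also have "dyad (sqrt T *\<^sub>R y) \<le>\<^sup>L A + dyad (sqrt T *\<^sub>R y)"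
      using A by (simp add: loewner_le_def)
    finally (loewner_trans) have "k *\<^sub>R dyad (root y) \<le>\<^sup>L \<phi> A + dyad v"
      unfolding t(2)[symmetric] v[symmetric]
      using A t(1) by (subst le_iff) (simp_all add: psd_add psd_scaleR)
    from loewner_le_quadratic[OF this, of w]
    have "k * (w \<bullet> root y)\<^sup>2 \<le> w \<bullet> (\<phi> A *v w)"
      using wv by (simp add: mat_vec_scaleR matrix_vector_mult_add_rdistrib inner_add_right
          inner_dyad inner_commute)
    then show False using w(2) by (simp add: k_def)
  qed
  then have "z \<in> span {root y}" by (rule span_singleton_swap) (simp add: y)
  then obtain c where "z = c *\<^sub>R root y" by (auto simp: span_singleton)
  then show ?thesis using that[of "c\<^sup>2"] z by (simp add: dyad_root dyad_scaleR)
qed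

section \<open>Additivity\<close>

text \<open>
  Go from \<open>A\<close> to \<open>A + dyad z + dyad y\<close> along the two sides of the parallelogram and compare the
  coefficients of \<open>\<phi> (dyad y)\<close>, which is not a multiple of \<open>\<phi> (dyad z)\<close>.
\<close>

lemma increment_independent:
  assumes A: "A \<in> psd_matrices" and yz: "y \<notin> span {z}"
  shows "\<phi> (A + dyad z + dyad y) - \<phi> (A + dyad z) = \<phi> (A + dyad y) - \<phi> A"
proof -
  obtain a where a: "\<phi> (A + dyad y) = \<phi> A + a *\<^sub>R \<phi> (dyad y)"
    using A by (rule add_dyad_direction)
  obtain b where b: "\<phi> (A + dyad z) = \<phi> A + b *\<^sub>R \<phi> (dyad z)"
    using A by (rule add_dyad_direction)
  obtain a' where a': "\<phi> (A + dyad z + dyad y) = \<phi> (A + dyad z) + a' *\<^sub>R \<phi> (dyad y)"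
    using psd_add[OF A psd_dyad] by (rule add_dyad_direction)
  obtain b' where b': "\<phi> (A + dyad y + dyad z) = \<phi> (A + dyad y) + b' *\<^sub>R \<phi> (dyad z)"
    using psd_add[OF A psd_dyad] by (rule add_dyad_direction)
  have "A + dyad y + dyad z = A + dyad z + dyad y" by simp
  then have "b *\<^sub>R \<phi> (dyad z) + a' *\<^sub>R \<phi> (dyad y) = a *\<^sub>R \<phi> (dyad y) + b' *\<^sub>R \<phi> (dyad z)"
    using a b a' b' by (metis (no_types, lifting) add.assoc add_left_cancel)
  then have "(a' - a) *\<^sub>R dyad (root y) = (b' - b) *\<^sub>R dyad (root z)"
    by (simp add: dyad_root algebra_simps)
  then have "a' - a = 0"
    by (rule scaled_dyads_eq_imp_zero) (simp add: root_parallel_iff yz)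
  then show ?thesis by (simp add: a a')
qed

text \<open>
  For \<open>z\<close> parallel to \<open>y\<close> the detour through a second direction \<open>x\<close> replaces \<open>dyad z\<close> by dyads that
  are not parallel to \<open>y\<close>.
\<close>

lemma increment_invariant:
  assumes A: "A \<in> psd_matrices"
  shows "\<phi> (A + dyad z + dyad y) - \<phi> (A + dyad z) = \<phi> (A + dyad y) - \<phi> A"
proof (cases "y \<in> span {z} \<and> y \<noteq> 0")
  case False
  then show ?thesis using increment_independent[OF A] by auto
next
  case True
  then have zy: "z \<in> span {y}" using span_singleton_swap by blast
  have "span {y} \<noteq> UNIV"
  proof
    assume "span {y} = UNIV"
    then have "dim {y} = CARD('n)" by (metis dim_span dim_UNIV DIM_cart DIM_real mult.right_neutral)
    then show False using dim_le_card'[of "{y}"] dim2 by simp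
  qed
  then obtain x where x: "x \<notin> span {y}" by blast
  define r where "r = sqrt (1 / 2)"
  define u where "u = r *\<^sub>R (x + z)"
  define v where "v = r *\<^sub>R (x - z)"
  have r: "r\<^sup>2 = 1 / 2" "r \<noteq> 0" by (simp_all add: r_def)
  \<comment> \<open>\<open>u\<close> and \<open>v\<close> arise from \<open>x\<close> and \<open>z\<close> by a rotation through 45 degrees.\<close>
  have rot: "dyad z + dyad x = dyad u + dyad v"
    unfolding u_def v_def dyad_scaleR r
    by (simp add: dyad_def vec_eq_iff algebra_simps)
  have notin: "y \<notin> span {r *\<^sub>R (x + w)}" if "w \<in> span {y}" for w
  proof
    assume "y \<in> span {r *\<^sub>R (x + w)}"
    then have "r *\<^sub>R (x + w) \<in> span {y}" using True span_singleton_swap by blast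
    then have "(1 / r) *\<^sub>R (r *\<^sub>R (x + w)) \<in> span {y}" by (rule span_scale)
    then have "x + w \<in> span {y}" using r by simp
    then have "x + w - w \<in> span {y}" using that by (rule span_diff)
    then show False using x by simp
  qed
  have yx: "y \<notin> span {x}" using x True span_singleton_swap by blast
  have yu: "y \<notin> span {u}" unfolding u_def by (rule notin[OF zy])
  have yv: "y \<notin> span {v}" unfolding v_def using notin[OF span_neg[OF zy]] by simp
  have "\<phi> (A + dyad z + dyad y) - \<phi> (A + dyad z)
      = \<phi> (A + dyad z + dyad x + dyad y) - \<phi> (A + dyad z + dyad x)"
    using increment_independent[OF psd_add[OF A psd_dyad] yx] by simp
  also have "A + dyad z + dyad x = A + dyad u + dyad v"
    using rot by (simp add: add.assoc)
  also have "\<phi> (A + dyad u + dyad v + dyad y) - \<phi> (A + dyad u + dyad v)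
      = \<phi> (A + dyad u + dyad y) - \<phi> (A + dyad u)"
    by (rule increment_independent[OF psd_add[OF A psd_dyad] yv])
  also have "\<dots> = \<phi> (A + dyad y) - \<phi> A"
    by (rule increment_independent[OF A yu])
  finally show ?thesis .
qed

lemma add_dyad_sum: "A \<in> dyad_sums \<Longrightarrow> \<phi> (A + dyad y) = \<phi> A + \<phi> (dyad y)"
proof (induction rule: dyad_sums.induct)
  case (add A z)
  show ?case
    using increment_invariant[OF dyad_sums_psd[OF add.hyps], of z y] add.IH
    by (simp add: algebra_simps)
qed simp

lemma additive:
  assumes "A \<in> dyad_sums" "B \<in> dyad_sums"
  shows "A + B \<in> dyad_sums" "\<phi> (A + B) = \<phi> A + \<phi> B"
proof -
  have "A + B \<in> dyad_sums \<and> \<phi> (A + B) = \<phi> A + \<phi> B"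
    using assms(2)
  proof (induction rule: dyad_sums.induct)
    case (add B y)
    then show ?case
      using dyad_sums.add[of "A + B" y] add_dyad_sum[of "A + B" y] add_dyad_sum[of B y]
      by (simp add: add.assoc)
  qed (simp add: assms)
  then show "A + B \<in> dyad_sums" "\<phi> (A + B) = \<phi> A + \<phi> B" by auto
qed

lemma scaleR_in_dyad_sums: "0 \<le> t \<Longrightarrow> t *\<^sub>R dyad y \<in> dyad_sums"
  by (simp add: dyad_sqrt dyad_in_dyad_sums)

section \<open>Homogeneity\<close>

lemma homogeneous_dyad:
  assumes "0 \<le> t"
  shows "\<phi> (t *\<^sub>R dyad y) = t *\<^sub>R \<phi> (dyad y)"
proof (cases "y = 0")
  case False
  have "\<exists>k\<ge>0. \<phi> (t *\<^sub>R dyad y) = k *\<^sub>R \<phi> (dyad y)" if t: "0 \<le> t" for t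
  proof -
    have "root (sqrt t *\<^sub>R y) \<in> span {root y}"
      by (simp add: root_parallel_iff span_base span_scale)
    then obtain c where "root (sqrt t *\<^sub>R y) = c *\<^sub>R root y" by (auto simp: span_singleton)
    moreover have "\<phi> (t *\<^sub>R dyad y) = dyad (root (sqrt t *\<^sub>R y))"
      by (simp only: dyad_sqrt[OF t] dyad_root)
    ultimately have "\<phi> (t *\<^sub>R dyad y) = c\<^sup>2 *\<^sub>R \<phi> (dyad y)"
      by (simp add: dyad_scaleR dyad_root)
    then show ?thesis by (intro exI[of _ "c\<^sup>2"]) simp
  qed
  then obtain f where f: "\<And>t. 0 \<le> t \<Longrightarrow> 0 \<le> f t"
    "\<And>t. 0 \<le> t \<Longrightarrow> \<phi> (t *\<^sub>R dyad y) = f t *\<^sub>R \<phi> (dyad y)" by metis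
  have Q: "\<phi> (dyad y) \<noteq> 0" using False by (simp add: dyad_root)
  have "f t = t * f 1"
  proof (rule additive_nonneg_imp_linear)
    fix s t :: real assume st: "0 \<le> s" "0 \<le> t"
    then have "f (s + t) *\<^sub>R \<phi> (dyad y) = (f s + f t) *\<^sub>R \<phi> (dyad y)"
      using additive(2)[OF scaleR_in_dyad_sums scaleR_in_dyad_sums, of s t y y]
      using st by (simp add: f(2)[symmetric] scaleR_add_left)
    then show "f (s + t) = f s + f t" using Q by simp
  qed (use f assms in auto)
  moreover have "(f 1 - 1) *\<^sub>R \<phi> (dyad y) = 0" using f(2)[of 1] by (simp add: scaleR_diff_left)
  then have "f 1 = 1" using Q by simp
  ultimately show ?thesis using f(2)[OF assms] by simp
qed simp

section \<open>Linearity on vectors\<close>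

text \<open>
  For \<open>a > 0\<close> the dyads of \<open>a *\<^sub>R x - y\<close> and \<open>a *\<^sub>R x + y\<close> expand into combinations of \<open>dyad x\<close>,
  \<open>dyad y\<close> and \<open>dyad (x + y)\<close>.  Moving the negative terms to the other side, \<open>\<phi>\<close> may be applied to these
  identities; evaluating at \<open>p\<close>, where the contribution of \<open>y\<close> vanishes, and dropping the nonnegative
  term of the expanded dyad leaves an inequality in each direction, up to an error proportional to
  \<open>a\<close>.
\<close>

lemma root_add_component:
  assumes p: "p \<bullet> root y = 0"
  shows "(p \<bullet> root (x + y))\<^sup>2 = (p \<bullet> root x)\<^sup>2"
proof -
  define q where "q v = (p \<bullet> root v)\<^sup>2" for v
  have q: "p \<bullet> (\<phi> (dyad v) *v p) = q v" for v
    by (simp add: q_def dyad_root inner_dyad inner_commute)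
  have qy: "q y = 0" using p by (simp add: q_def)
  have up: "q (x + y) \<le> q x + a * q x" if a: "0 < a" for a :: real
  proof -
    have "dyad (a *\<^sub>R x - y) + a *\<^sub>R dyad (x + y) = (a\<^sup>2 + a) *\<^sub>R dyad x + (1 + a) *\<^sub>R dyad y"
      by (simp add: dyad_def vec_eq_iff power2_eq_square algebra_simps)
    then have "\<phi> (dyad (a *\<^sub>R x - y) + a *\<^sub>R dyad (x + y))
        = \<phi> ((a\<^sup>2 + a) *\<^sub>R dyad x + (1 + a) *\<^sub>R dyad y)" by simp
    moreover have "0 \<le> a" "0 \<le> a\<^sup>2 + a" "0 \<le> 1 + a" using a by simp_all
    ultimately have "\<phi> (dyad (a *\<^sub>R x - y)) + a *\<^sub>R \<phi> (dyad (x + y))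
        = (a\<^sup>2 + a) *\<^sub>R \<phi> (dyad x) + (1 + a) *\<^sub>R \<phi> (dyad y)"
      by (simp only: additive dyad_in_dyad_sums scaleR_in_dyad_sums homogeneous_dyad)
    then have "p \<bullet> ((\<phi> (dyad (a *\<^sub>R x - y)) + a *\<^sub>R \<phi> (dyad (x + y))) *v p)
        = p \<bullet> (((a\<^sup>2 + a) *\<^sub>R \<phi> (dyad x) + (1 + a) *\<^sub>R \<phi> (dyad y)) *v p)" by simp
    then have "q (a *\<^sub>R x - y) + a * q (x + y) = a * (q x + a * q x)"
      by (simp add: matrix_vector_mult_add_rdistrib mat_vec_scaleR inner_add_right q qy
          power2_eq_square algebra_simps)
    moreover have "0 \<le> q (a *\<^sub>R x - y)" by (simp add: q_def)
    ultimately have "a * q (x + y) \<le> a * (q x + a * q x)" by linarith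
    then show ?thesis using a by simp
  qed
  have low: "q x \<le> q (x + y) + a * q x" if a: "0 < a" for a :: real
  proof -
    have "dyad (a *\<^sub>R x + y) + (a *\<^sub>R dyad x + a *\<^sub>R dyad y)
        = a *\<^sub>R dyad (x + y) + (a\<^sup>2 *\<^sub>R dyad x + dyad y)"
      by (simp add: dyad_def vec_eq_iff power2_eq_square algebra_simps)
    then have "\<phi> (dyad (a *\<^sub>R x + y) + (a *\<^sub>R dyad x + a *\<^sub>R dyad y))
        = \<phi> (a *\<^sub>R dyad (x + y) + (a\<^sup>2 *\<^sub>R dyad x + dyad y))" by simp
    moreover have "0 \<le> a" "0 \<le> a\<^sup>2" using a by simp_all
    ultimately have "\<phi> (dyad (a *\<^sub>R x + y)) + (a *\<^sub>R \<phi> (dyad x) + a *\<^sub>R \<phi> (dyad y))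
        = a *\<^sub>R \<phi> (dyad (x + y)) + (a\<^sup>2 *\<^sub>R \<phi> (dyad x) + \<phi> (dyad y))"
      by (simp only: additive dyad_in_dyad_sums scaleR_in_dyad_sums homogeneous_dyad)
    then have "p \<bullet> ((\<phi> (dyad (a *\<^sub>R x + y)) + (a *\<^sub>R \<phi> (dyad x) + a *\<^sub>R \<phi> (dyad y))) *v p)
        = p \<bullet> ((a *\<^sub>R \<phi> (dyad (x + y)) + (a\<^sup>2 *\<^sub>R \<phi> (dyad x) + \<phi> (dyad y))) *v p)" by simp
    then have "q (a *\<^sub>R x + y) + a * q x = a * (q (x + y) + a * q x)"
      by (simp add: matrix_vector_mult_add_rdistrib mat_vec_scaleR inner_add_right q qy
          power2_eq_square algebra_simps)
    moreover have "0 \<le> q (a *\<^sub>R x + y)" by (simp add: q_def)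
    ultimately have "a * q x \<le> a * (q (x + y) + a * q x)" by linarith
    then show ?thesis using a by simp
  qed
  have small: "r \<le> s" if "\<And>a. 0 < a \<Longrightarrow> r \<le> s + a * c" "0 \<le> c" for r s c :: real
  proof (rule field_le_epsilon)
    fix e :: real assume "0 < e"
    have "r \<le> s + e / (c + 1) * c" using that(1)[of "e / (c + 1)"] that(2) \<open>0 < e\<close> by simp
    also have "e / (c + 1) * c \<le> e" using that \<open>0 < e\<close> by (simp add: field_simps)
    finally show "r \<le> s + e" by simp
  qed
  have "0 \<le> q x" by (simp add: q_def)
  then have "q (x + y) = q x" using small[OF up] small[OF low] by (simp add: order_antisym)
  then show ?thesis by (simp add: q_def)
qed

text \<open>
  Testing with \<open>root_add_component\<close> against vectors orthogonal to both \<open>root x\<close> and \<open>root y\<close> puts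
  \<open>root (x + y)\<close> into their span; testing against vectors orthogonal to just one of them shows that
  both coefficients are \<open>\<plusminus> 1\<close>.  A common sign is irrelevant for dyads, so \<open>root x\<close> may be kept and the
  relative sign moved into \<open>v\<close>.
\<close>

lemma root_add_up_to_sign:
  obtains v where "dyad v = \<phi> (dyad y)" "\<phi> (dyad (x + y)) = dyad (root x + v)"
proof (cases "y \<in> span {x}")
  case True
  then obtain c where c: "y = c *\<^sub>R x" by (auto simp: span_singleton)
  have Q: "\<phi> (dyad (a *\<^sub>R x)) = dyad (a *\<^sub>R root x)" for a
    by (simp only: dyad_scaleR homogeneous_dyad zero_le_power2 dyad_root)
  have "x + y = (1 + c) *\<^sub>R x" by (simp add: c scaleR_add_left)
  then have "\<phi> (dyad (x + y)) = dyad (root x + c *\<^sub>R root x)"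
    using Q[of "1 + c"] by (simp add: scaleR_add_left)
  then show ?thesis using that[of "c *\<^sub>R root x"] Q[of c] by (simp add: c)
next
  case False
  show ?thesis
  proof (cases "x = 0")
    case True then show ?thesis using that[of "root y"] by (simp add: dyad_root)
  next
    case x: False
    define u v w where "u = root x" and "v = root y" and "w = root (x + y)"
    have vu: "v \<notin> span {u}" using False by (simp add: u_def v_def root_parallel_iff)
    then have uv: "u \<notin> span {v}" using span_singleton_swap[of u v] x by (auto simp: u_def)
    have pv: "(p \<bullet> w)\<^sup>2 = (p \<bullet> u)\<^sup>2" if "p \<bullet> v = 0" for p
      using root_add_component[of p y x] that by (simp add: u_def v_def w_def)
    have pu: "(p \<bullet> w)\<^sup>2 = (p \<bullet> v)\<^sup>2" if "p \<bullet> u = 0" for p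
      using root_add_component[of p x y] that by (simp add: u_def v_def w_def add.commute)
    obtain s z where sz: "s \<in> span {u, v}" "\<And>r. r \<in> span {u, v} \<Longrightarrow> orthogonal z r" "w = s + z"
      by (rule orthogonal_subspace_decomp_exists[of "{u, v}" w]) blast
    have z: "z \<bullet> u = 0" "z \<bullet> v = 0" "z \<bullet> s = 0"
      using sz(1,2) by (simp_all add: orthogonal_def span_base)
    then have "z \<bullet> z = 0" using pv[of z] by (simp add: sz(3) inner_add_right)
    then have "w \<in> span {u, v}" using sz by simp
    then obtain a b where "w - a *\<^sub>R u = b *\<^sub>R v"
      by (auto simp: span_breakdown_eq span_singleton)
    then have w: "w = a *\<^sub>R u + b *\<^sub>R v" by (simp add: algebra_simps)
    obtain p where p: "p \<bullet> v = 0" "p \<bullet> u \<noteq> 0" using uv by (rule separating_vector)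
    have a: "a\<^sup>2 = 1" using pv[OF p(1)] p by (simp add: w inner_add_right power_mult_distrib)
    obtain r where r: "r \<bullet> u = 0" "r \<bullet> v \<noteq> 0" using vu by (rule separating_vector)
    have b: "b\<^sup>2 = 1" using pu[OF r(1)] r by (simp add: w inner_add_right power_mult_distrib)
    have "w = a *\<^sub>R (u + (a * b) *\<^sub>R v)"
      using a by (simp add: w scaleR_add_right power2_eq_square flip: mult.assoc)
    then have "dyad w = dyad (u + (a * b) *\<^sub>R v)"
      using a by (simp add: dyad_scaleR)
    moreover have "dyad ((a * b) *\<^sub>R v) = dyad v"
      using a b by (simp add: dyad_scaleR power_mult_distrib)
    ultimately show ?thesis
      using that[of "(a * b) *\<^sub>R v"] by (simp add: dyad_root u_def v_def w_def)
  qed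
qed

text \<open>
  The polarization \<open>M\<close> is linear in \<open>y\<close> because \<open>\<phi>\<close> respects the identities between dyads that
  express the bilinearity of \<open>x y\<^sup>t + y x\<^sup>t\<close>.
\<close>

lemma linear_on_dyads:
  obtains S where "\<And>y. \<phi> (dyad y) = dyad (S *v y)"
proof -
  define x :: "real ^ 'n" where "x = axis undefined 1"
  have x: "x \<noteq> 0" by (simp add: x_def axis_eq_0_iff)
  define u where "u = root x"
  have u: "u \<noteq> 0" using x by (simp add: u_def)
  define M where "M y = \<phi> (dyad (x + y)) - \<phi> (dyad x) - \<phi> (dyad y)" for y
  have M_add: "M (y + z) = M y + M z" for y z
  proof -
    have "dyad (x + (y + z)) + dyad x + dyad y + dyad z = dyad (x + y) + dyad (x + z) + dyad (y + z)"
      by (simp add: dyad_def vec_eq_iff algebra_simps)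
    then have "\<phi> (dyad (x + (y + z)) + dyad x + dyad y + dyad z)
      = \<phi> (dyad (x + y) + dyad (x + z) + dyad (y + z))" by simp
    then have "\<phi> (dyad (x + (y + z))) + \<phi> (dyad x) + \<phi> (dyad y) + \<phi> (dyad z)
      = \<phi> (dyad (x + y)) + \<phi> (dyad (x + z)) + \<phi> (dyad (y + z))"
      by (simp only: additive dyad_in_dyad_sums)
    then show ?thesis by (simp add: M_def algebra_simps)
  qed
  have M_pos: "M (c *\<^sub>R y) = c *\<^sub>R M y" if c: "0 \<le> c" for c y
  proof -
    have "dyad (x + c *\<^sub>R y) + c *\<^sub>R dyad x + c *\<^sub>R dyad y
        = c *\<^sub>R dyad (x + y) + dyad x + dyad (c *\<^sub>R y)"
      by (simp add: dyad_def vec_eq_iff algebra_simps)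
    then have "\<phi> (dyad (x + c *\<^sub>R y) + c *\<^sub>R dyad x + c *\<^sub>R dyad y)
        = \<phi> (c *\<^sub>R dyad (x + y) + dyad x + dyad (c *\<^sub>R y))" by simp
    then have "\<phi> (dyad (x + c *\<^sub>R y)) + c *\<^sub>R \<phi> (dyad x) + c *\<^sub>R \<phi> (dyad y)
        = c *\<^sub>R \<phi> (dyad (x + y)) + \<phi> (dyad x) + \<phi> (dyad (c *\<^sub>R y))"
      by (simp only: additive dyad_in_dyad_sums scaleR_in_dyad_sums c homogeneous_dyad)
    then show ?thesis by (simp add: M_def algebra_simps)
  qed
  have "M 0 = 0" by (simp add: M_def)
  then have M_neg: "M (- y) = - M y" for y
    using M_add[of y "- y"] by (simp add: eq_neg_iff_add_eq_0 add.commute)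
  have M_scale: "M (c *\<^sub>R y) = c *\<^sub>R M y" for c y
    using M_pos[of c y] M_pos[of "- c" y] M_neg[of "c *\<^sub>R y"] by (cases "0 \<le> c") auto
  \<comment> \<open>\<open>G y\<close> solves \<open>M y = u v\<^sup>t + v u\<^sup>t\<close> for \<open>v\<close>: applying both sides to \<open>u\<close> gives
    \<open>M y u = (u \<bullet> v) u + (u \<bullet> u) v\<close>, and the inner product with \<open>u\<close> then yields \<open>u \<bullet> v\<close>.\<close>
  define G where
    "G y = (1 / (u \<bullet> u)) *\<^sub>R (M y *v u - ((u \<bullet> (M y *v u)) / (2 * (u \<bullet> u))) *\<^sub>R u)" for y
  have "linear G"
  proof (rule linearI)
    fix y z c
    show "G (y + z) = G y + G z"
      by (simp add: G_def M_add matrix_vector_mult_add_rdistrib inner_add_right add_divide_distrib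
          scaleR_add_left scaleR_add_right scaleR_diff_right)
    show "G (c *\<^sub>R y) = c *\<^sub>R G y"
      by (simp add: G_def M_scale mat_vec_scaleR scaleR_diff_right)
  qed
  have "\<phi> (dyad y) = dyad (G y)" for y
  proof -
    obtain v where v: "dyad v = \<phi> (dyad y)" "\<phi> (dyad (x + y)) = dyad (u + v)"
      unfolding u_def by (rule root_add_up_to_sign)
    have M: "M y = dyad (u + v) - dyad u - dyad v"
      by (simp only: M_def v(2) v(1)[symmetric] dyad_root[of x] u_def)
    have Mu: "M y *v u = (u \<bullet> v) *\<^sub>R u + (u \<bullet> u) *\<^sub>R v"
      by (simp add: M matrix_vector_mult_diff_rdistrib dyad_mult_vec inner_add_left
          inner_commute algebra_simps)
    have uMu: "u \<bullet> (M y *v u) = 2 * (u \<bullet> u) * (u \<bullet> v)"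
      by (simp add: Mu inner_add_right)
    have "G y = v"
      unfolding G_def uMu using u by (simp add: Mu)
    then show ?thesis by (simp add: v)
  qed
  then show ?thesis
    using that[of "matrix G"] matrix_vector_mul(2)[OF \<open>linear G\<close>] by metis
qed

end

section \<open>The classification\<close>

lemma congruence_quadratic:
  "x \<bullet> ((S ** A ** transpose S) *v x) = (transpose S *v x) \<bullet> (A *v (transpose S *v x))"
  for S A :: "real ^ 'n ^ 'n"
proof -
  have "x \<bullet> ((S ** A ** transpose S) *v x) = x \<bullet> (S *v (A *v (transpose S *v x)))"
    by (simp only: matrix_vector_mul_assoc matrix_mul_assoc)
  also have "\<dots> = (x v* S) \<bullet> (A *v (transpose S *v x))"
    by (simp only: dot_lmul_matrix)
  finally show ?thesis by (simp only: transpose_matrix_vector)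
qed

lemma congruence_psd:
  fixes S :: "real ^ 'n ^ 'n"
  assumes "A \<in> psd_matrices"
  shows "S ** A ** transpose S \<in> psd_matrices"
  using assms
  by (simp add: psd_matrices_def congruence_quadratic matrix_transpose_mul matrix_mul_assoc
      del: transpose_matrix_vector)

lemma congruence_diff:
  "S ** (B - A) ** transpose S = S ** B ** transpose S - S ** A ** transpose S"
  for S A B :: "real ^ 'n ^ 'n"
  by (simp add: matrix_eq matrix_vector_mul_assoc[symmetric] matrix_vector_mult_diff_rdistrib
      matrix_vector_mult_diff_distrib del: transpose_matrix_vector)

lemma congruence_inverse:
  fixes A S T :: "real ^ 'n ^ 'n"
  assumes "T ** S = mat 1"
  shows "T ** (S ** A ** transpose S) ** transpose T = A"
proof -
  have "T ** (S ** A ** transpose S) ** transpose T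
      = (T ** S) ** A ** transpose (T ** S)"
    by (simp add: matrix_transpose_mul matrix_mul_assoc)
  then show ?thesis by (simp add: assms)
qed

lemma congruence_loewner_iff:
  fixes S :: "real ^ 'n ^ 'n"
  assumes "invertible S"
  shows "S ** A ** transpose S \<le>\<^sup>L S ** B ** transpose S \<longleftrightarrow> A \<le>\<^sup>L B"
proof -
  obtain T where T: "T ** S = mat 1" using assms by (auto simp: invertible_def)
  have "B - A \<in> psd_matrices" if "S ** (B - A) ** transpose S \<in> psd_matrices"
    using congruence_psd[OF that, of T] by (simp add: congruence_inverse[OF T])
  then show ?thesis
    unfolding loewner_le_def congruence_diff[symmetric] using congruence_psd by blast
qed

lemma congruence_surj:
  fixes S :: "real ^ 'n ^ 'n"
  assumes "invertible S"
  shows "(\<lambda>A. S ** A ** transpose S) ` psd_matrices = psd_matrices"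
proof -
  obtain T where T: "S ** T = mat 1" using assms by (auto simp: invertible_def)
  show ?thesis
  proof (intro equalityI subsetI)
    fix B assume "B \<in> (\<lambda>A. S ** A ** transpose S) ` psd_matrices"
    then show "B \<in> psd_matrices" using congruence_psd by blast
  next
    fix B :: "real ^ 'n ^ 'n" assume "B \<in> psd_matrices"
    then have "T ** B ** transpose T \<in> psd_matrices" by (rule congruence_psd)
    then show "B \<in> (\<lambda>A. S ** A ** transpose S) ` psd_matrices"
      using congruence_inverse[OF T, of B] by (metis image_eqI)
  qed
qed

text \<open>
  Since \<open>S\<close> is onto, every dyad is the image of a dyad under both \<open>\<phi>\<close> and the congruence by \<open>S\<close>, and
  both maps respect the order; so \<open>\<phi> A\<close> and \<open>S ** A ** transpose S\<close> dominate the same dyads.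
\<close>

lemma (in loewner_automorphism) eq_congruence:
  obtains S where "invertible S" "\<And>A. A \<in> psd_matrices \<Longrightarrow> \<phi> A = S ** A ** transpose S"
proof -
  obtain S where S: "\<And>y. \<phi> (dyad y) = dyad (S *v y)" using linear_on_dyads by blast
  have onto: "\<exists>y. S *v y = v" for v
  proof -
    obtain y where "\<phi> (dyad y) = dyad v" by (rule preimage_dyad)
    then have "S *v y = v \<or> S *v y = - v" by (metis S dyad_eq_imp)
    then have "S *v y = v \<or> S *v (- y) = v" by (auto simp: vec.neg)
    then show ?thesis by blast
  qed
  then have "surj ((*v) S)" by (metis surjI)
  then have inv: "invertible S"
    using matrix_right_invertible_surjective invertible_right_inverse by blast
  have "\<phi> A = S ** A ** transpose S" if A: "A \<in> psd_matrices" for A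
  proof -
    have same: "dyad v \<le>\<^sup>L \<phi> A \<longleftrightarrow> dyad v \<le>\<^sup>L S ** A ** transpose S" for v
    proof -
      obtain y where y: "v = S *v y" using onto by metis
      have "dyad v \<le>\<^sup>L \<phi> A \<longleftrightarrow> dyad y \<le>\<^sup>L A" using A by (simp add: y le_iff flip: S)
      also have "\<dots> \<longleftrightarrow> dyad v \<le>\<^sup>L S ** A ** transpose S"
        by (simp add: y congruence_loewner_iff[OF inv] flip: congruence_dyad)
      finally show ?thesis .
    qed
    show ?thesis
      by (rule loewner_antisym; rule loewner_le_if_dyads_below)
        (use same A congruence_psd in auto)
  qed
  with inv show ?thesis by (rule that)
qed

theorem theorem1:
  fixes \<phi> :: "real ^ 'n ^ 'n \<Rightarrow> real ^ 'n ^ 'n"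
  assumes "CARD('n) \<ge> 2"
    and "\<phi> \<in> psd_matrices \<rightarrow> psd_matrices"
  shows "(\<phi> ` psd_matrices = psd_matrices \<and> preserves_loewner_both \<phi>) \<longleftrightarrow>
    (\<exists>S :: real ^ 'n ^ 'n. invertible S \<and>
       (\<forall>A \<in> psd_matrices. \<phi> A = S ** A ** transpose S))"
proof
  assume "\<phi> ` psd_matrices = psd_matrices \<and> preserves_loewner_both \<phi>"
  then interpret loewner_automorphism \<phi>
    using assms(1) by unfold_locales auto
  show "\<exists>S :: real ^ 'n ^ 'n. invertible S \<and>
      (\<forall>A \<in> psd_matrices. \<phi> A = S ** A ** transpose S)"
    using eq_congruence by metis
next
  assume "\<exists>S :: real ^ 'n ^ 'n. invertible S \<and>
      (\<forall>A \<in> psd_matrices. \<phi> A = S ** A ** transpose S)"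
  then obtain S :: "real ^ 'n ^ 'n" where S: "invertible S"
    "\<And>A. A \<in> psd_matrices \<Longrightarrow> \<phi> A = S ** A ** transpose S" by blast
  have "\<phi> ` psd_matrices = (\<lambda>A. S ** A ** transpose S) ` psd_matrices"
    using S(2) by (rule image_cong[OF refl])
  then show "\<phi> ` psd_matrices = psd_matrices \<and> preserves_loewner_both \<phi>"
    using congruence_surj[OF S(1)] congruence_loewner_iff[OF S(1)]
    by (simp add: preserves_loewner_both_def S(2))
qed

end
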